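(* Let $n\ge 5$ be an odd integer. Then the Goldberg Snark graph $G_n$ admits a Cordial labeling.
   Context: **Goldberg Snark $G_n$.** For an odd integer $n\ge 5$, $G_n$ is the simple undirected cubic graph with the $8n$ vertices $v_{i,j}$ ($1\le i\le n$, $1\le j\le 8$) and the following $12n$ edges, where the first index is read cyclically modulo $n$ (so $v_{n+1,j}=v_{1,j}$). For every $1\le i\le n$: - inside the $i$-th block: $v_{i,1}v_{i,3}$, $v_{i,2}v_{i,4}$, $v_{i,3}v_{i,5}$, $v_{i,5}v_{i,7}$, $v_{i,1}v_{i,6}$, $v_{i,3}v_{i,8}$, $v_{i,1}v_{i,2}$, $v_{i,4}v_{i,5}$, $v_{i,6}v_{i,7}$; - between consecutive blocks: $v_{i,8}v_{i+1,8}$, $v_{i,6}v_{i+1,7}$, $v_{i,4}v_{i+1,2}$. **Cordial labeling.** Let $G=(V,E)$ be a finite simple graph. A vertex labeling $f:V(G)\to\{0,1\}$ induces the edge labeling $f^*:E(G)\to\{0,1\}$, $f^*(uv)=|f(u)-f(v)|$. For $i\in\{0,1\}$ let $v_f(i)$ be the number of vertices $v$ with $f(v)=i$, and $e_f(i)$ the number of edges $e$ with $f^*(e)=i$. Then $f$ is a Cordial labeling of $G$ if $|v_f(0)-v_f(1)|\le 1$ and $|e_f(0)-e_f(1)|\le 1$. *)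

theory Defs
  imports Main
begin

definition simple_graph :: "'a set \<Rightarrow> 'a set set \<Rightarrow> bool" where
  "simple_graph V E \<longleftrightarrow>
     finite V \<and> (\<forall>e\<in>E. e \<subseteq> V \<and> card e = 2)"

(* The expression is symmetric in u and v, so the description is well defined on
   every set of the form {u, v}; see edge_label_pair. *)
definition edge_label :: "('a \<Rightarrow> int) \<Rightarrow> 'a set \<Rightarrow> int" where
  "edge_label f e = (THE k. \<exists>u v. e = {u, v} \<and> k = \<bar>f u - f v\<bar>)"

lemma edge_label_pair: "edge_label f {u, v} = \<bar>f u - f v\<bar>"
  unfolding edge_label_def by (rule the_equality) (auto simp: doubleton_eq_iff)

definition vertex_count :: "'a set \<Rightarrow> ('a \<Rightarrow> int) \<Rightarrow> int \<Rightarrow> nat" where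
  "vertex_count V f i = card {v \<in> V. f v = i}"

definition edge_count :: "'a set set \<Rightarrow> ('a \<Rightarrow> int) \<Rightarrow> int \<Rightarrow> nat" where
  "edge_count E f i = card {e \<in> E. edge_label f e = i}"

(* Meaningful for simple_graph V E; values of f outside V are irrelevant. *)
definition cordial_labeling :: "'a set \<Rightarrow> 'a set set \<Rightarrow> ('a \<Rightarrow> int) \<Rightarrow> bool" where
  "cordial_labeling V E f \<longleftrightarrow>
     (\<forall>v\<in>V. f v \<in> {0, 1}) \<and>
     \<bar>int (vertex_count V f 0) - int (vertex_count V f 1)\<bar> \<le> 1 \<and>
     \<bar>int (edge_count E f 0) - int (edge_count E f 1)\<bar> \<le> 1"

(* The vertex v_{i,j} is the pair (i, j). *)
definition goldberg_verts :: "nat \<Rightarrow> (nat \<times> nat) set" where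
  "goldberg_verts n = {1..n} \<times> {1..8}"

(* Cyclic successor on {1..n}: n is sent to 1. *)
definition cyc_suc :: "nat \<Rightarrow> nat \<Rightarrow> nat" where
  "cyc_suc n i = (if i = n then 1 else i + 1)"

definition goldberg_edges :: "nat \<Rightarrow> (nat \<times> nat) set set" where
  "goldberg_edges n = (\<Union>i\<in>{1..n}.
     {{(i,1), (i,3)}, {(i,2), (i,4)}, {(i,3), (i,5)},
      {(i,5), (i,7)}, {(i,1), (i,6)}, {(i,3), (i,8)},
      {(i,1), (i,2)}, {(i,4), (i,5)}, {(i,6), (i,7)},
      {(i,8), (cyc_suc n i,8)}, {(i,6), (cyc_suc n i,7)}, {(i,4), (cyc_suc n i,2)}})"

lemma card_goldberg_verts: "card (goldberg_verts n) = 8 * n"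
  by (simp add: goldberg_verts_def)

lemma simple_graph_goldberg:
  assumes "n \<ge> 5"
  shows "simple_graph (goldberg_verts n) (goldberg_edges n)"
proof -
  have s: "cyc_suc n i \<in> {1..n} \<and> i \<noteq> cyc_suc n i" if "i \<in> {1..n}" for i
    using that assms by (auto simp: cyc_suc_def)
  show ?thesis
    unfolding simple_graph_def goldberg_verts_def goldberg_edges_def
    using s by (auto simp: card_insert_if)
qed

lemma card_goldberg_edges:
  assumes "n \<ge> 5"
  shows "card (goldberg_edges n) = 12 * n"
proof -
  have s: "i \<noteq> cyc_suc n i" "cyc_suc n (cyc_suc n i) \<noteq> i" if "i \<in> {1..n}" for i
    using that assms by (auto simp: cyc_suc_def)
  let ?B = "\<lambda>i. {{(i,1), (i,3)}, {(i,2), (i,4)}, {(i,3), (i,5)},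
      {(i,5), (i,7)}, {(i,1), (i,6)}, {(i,3), (i,8)},
      {(i,1), (i,2)}, {(i,4), (i,5)}, {(i,6), (i,7)},
      {(i,8), (cyc_suc n i,8)}, {(i,6), (cyc_suc n i,7)}, {(i,4), (cyc_suc n i,2)}}
      :: (nat \<times> nat) set set"
  have fst_B: "fst ` e = {i} \<or> fst ` e = {i, cyc_suc n i}" if "e \<in> ?B i" for e i
    using that by (elim insertE emptyE) simp_all
  have fst_eq: "i = k"
    if "i \<in> {1..n}" "k \<in> {1..n}"
      "S = {i} \<or> S = {i, cyc_suc n i}" "S = {k} \<or> S = {k, cyc_suc n k}" for i k S
    using s[OF that(1)] s[OF that(2)] that(3,4)
    by (elim disjE) (auto simp: doubleton_eq_iff)
  have disj: "?B i \<inter> ?B k = {}" if "i \<in> {1..n}" "k \<in> {1..n}" "i \<noteq> k" for i k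
  proof (rule equals0I)
    fix e assume "e \<in> ?B i \<inter> ?B k"
    from fst_eq[OF that(1,2) fst_B[OF IntD1[OF this]] fst_B[OF IntD2[OF this]]] that(3)
    show False by contradiction
  qed
  have card_B: "card (?B i) = 12" if "i \<in> {1..n}" for i
    using s(1)[OF that] by (simp add: doubleton_eq_iff)
  have "card (goldberg_edges n) = (\<Sum>i\<in>{1..n}. card (?B i))"
    unfolding goldberg_edges_def
  proof (rule card_UN_disjoint)
    show "\<forall>i\<in>{1..n}. \<forall>j\<in>{1..n}. i \<noteq> j \<longrightarrow> ?B i \<inter> ?B j = {}"
      by (intro ballI impI disj)
  qed simp_all
  also have "\<dots> = (\<Sum>i\<in>{1..n}. 12)"
    by (rule sum.cong[OF refl card_B])
  finally show ?thesis by simp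
qed

end

(* The labeling that is 1 on columns 4, 6, 7, 8 and 0 on the others does not depend on the block.
   Each block has four vertices of either label, and six of its twelve edges (counting the edges
   that leave it forwards) join different labels. So each edge label occurs at most 6 n times,
   hence exactly 6 n times because there are 12 n edges; this avoids any disjointness argument. *)
theory Submission
  imports Defs
begin

definition column_label :: "nat \<times> nat \<Rightarrow> int" where
  "column_label v = (if snd v \<in> {4, 6, 7, 8} then 1 else 0)"

lemma vertex_count_column_label:
  "vertex_count (goldberg_verts n) column_label 0 = 4 * n"
  "vertex_count (goldberg_verts n) column_label 1 = 4 * n"
proof -
  have "{v \<in> goldberg_verts n. column_label v = 0} = {1..n} \<times> {1, 2, 3, 5}"
    by (auto simp: goldberg_verts_def column_label_def split: if_splits)
  then show "vertex_count (goldberg_verts n) column_label 0 = 4 * n"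
    by (simp add: vertex_count_def)
  have "{v \<in> goldberg_verts n. column_label v = 1} = {1..n} \<times> {4, 6, 7, 8}"
    by (auto simp: goldberg_verts_def column_label_def split: if_splits)
  then show "vertex_count (goldberg_verts n) column_label 1 = 4 * n"
    by (simp add: vertex_count_def)
qed

text \<open>Lists serve as index families because the bound needs only their lengths: neither
  distinct entries nor disjointness for different \<open>i\<close> has to be shown.\<close>

lemma card_le_UN_list:
  assumes "S \<subseteq> (\<Union>i\<in>I. set (xs i))" "finite I" "\<And>i. i \<in> I \<Longrightarrow> length (xs i) \<le> k"
  shows "card S \<le> k * card I"
proof -
  have "card S \<le> card (\<Union>i\<in>I. set (xs i))"
    using assms(1,2) by (intro card_mono) auto
  also have "\<dots> \<le> (\<Sum>i\<in>I. card (set (xs i)))"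
    by (rule card_UN_le[OF assms(2)])
  also have "\<dots> \<le> (\<Sum>i\<in>I. k)"
    using assms(3) card_length le_trans by (blast intro: sum_mono)
  also have "\<dots> = k * card I"
    by simp
  finally show ?thesis .
qed

lemma edge_count_column_label_le:
  "edge_count (goldberg_edges n) column_label 0 \<le> 6 * n"
  "edge_count (goldberg_edges n) column_label 1 \<le> 6 * n"
proof -
  \<comment> \<open>The twelve edges of block \<open>i\<close> split by label: \<open>A i\<close>
    has those with equally labeled ends, \<open>B i\<close> the others.\<close>
  define A :: "nat \<Rightarrow> (nat \<times> nat) set list" where
    "A i = [{(i,1), (i,3)}, {(i,3), (i,5)}, {(i,1), (i,2)}, {(i,6), (i,7)},
      {(i,8), (cyc_suc n i,8)}, {(i,6), (cyc_suc n i,7)}]" for i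
  define B :: "nat \<Rightarrow> (nat \<times> nat) set list" where
    "B i = [{(i,2), (i,4)}, {(i,5), (i,7)}, {(i,1), (i,6)}, {(i,3), (i,8)},
      {(i,4), (i,5)}, {(i,4), (cyc_suc n i,2)}]" for i
  have E: "goldberg_edges n = (\<Union>i\<in>{1..n}. set (A i) \<union> set (B i))"
    unfolding goldberg_edges_def A_def B_def
    by (simp only: list.set Un_insert_left Un_empty_left insert_commute)
  \<comment> \<open>\<open>column_label\<close> reads only the second component, so edges into the
    next block need no case split on \<open>cyc_suc\<close>, not even from block \<open>n\<close>
    back to block 1.\<close>
  have A: "edge_label column_label e = 0" if "e \<in> set (A i)" for e i
    using that unfolding A_def list.set
    by (elim insertE emptyE) (simp_all add: edge_label_pair column_label_def)
  have B: "edge_label column_label e = 1" if "e \<in> set (B i)" for e i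
    using that unfolding B_def list.set
    by (elim insertE emptyE) (simp_all add: edge_label_pair column_label_def)
  \<comment> \<open>An edge with label 0 lies in no \<open>B i\<close>, since the edges there have
    label 1.\<close>
  have "{e \<in> goldberg_edges n. edge_label column_label e = 0} \<subseteq> (\<Union>i\<in>{1..n}. set (A i))"
    unfolding E using B by fastforce
  from card_le_UN_list[OF this, of 6]
  show "edge_count (goldberg_edges n) column_label 0 \<le> 6 * n"
    by (simp add: edge_count_def A_def)
  have "{e \<in> goldberg_edges n. edge_label column_label e = 1} \<subseteq> (\<Union>i\<in>{1..n}. set (B i))"
    unfolding E using A by fastforce
  from card_le_UN_list[OF this, of 6]
  show "edge_count (goldberg_edges n) column_label 1 \<le> 6 * n"
    by (simp add: edge_count_def B_def)
qed

text \<open>Needed so that the two label classes cover all edges, which turns the upper bounds into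
  equalities.\<close>

lemma edge_label_column_label:
  assumes "e \<in> goldberg_edges n"
  shows "edge_label column_label e \<in> {0, 1}"
  using assms unfolding goldberg_edges_def
  by (elim UN_E insertE emptyE) (simp_all add: edge_label_pair column_label_def)

theorem theorem1:
  fixes n :: nat
  assumes "n \<ge> 5" and "odd n"
  shows "\<exists>f. cordial_labeling (goldberg_verts n) (goldberg_edges n) f"
proof
  let ?E = "\<lambda>k. {e \<in> goldberg_edges n. edge_label column_label e = k}"
  have "goldberg_edges n = ?E 0 \<union> ?E 1"
    using edge_label_column_label by blast
  \<comment> \<open>Subadditivity of \<open>card\<close> suffices here. The exact edge count brings
    in \<open>n \<ge> 5\<close>.\<close>
  then have "12 * n \<le> edge_count (goldberg_edges n) column_label 0
      + edge_count (goldberg_edges n) column_label 1"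
    using card_Un_le[of "?E 0" "?E 1"] card_goldberg_edges[OF assms(1)]
    by (simp add: edge_count_def)
  then have "edge_count (goldberg_edges n) column_label 0
      = edge_count (goldberg_edges n) column_label 1"
    using edge_count_column_label_le[of n] by linarith
  then show "cordial_labeling (goldberg_verts n) (goldberg_edges n) column_label"
    by (simp add: cordial_labeling_def vertex_count_column_label column_label_def)
qed

end
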